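(* Let $N\ge 1$, $P>0$, let $J\in\mathbb{R}^{2N\times 2N}$ be nonsingular and skew-symmetric, and let $H:\mathbb{R}\to\mathbb{R}^{2N\times 2N}$ satisfy $H(t)^T=H(t)=H(t+P)$ for all $t$. If the Hamiltonian system $J\,\frac{dX(t)}{dt}=H(t)X(t)$, $X(0)=I_{2N}$, is strongly stable, then there exists $\varepsilon>0$ such that for every vector $u\in\mathbb{R}^{2N}$ for which $$E(t)=(Juu^TH(t))^T+Juu^TH(t)+(uu^TJ)^TH(t)(uu^TJ)$$ satisfies $\|E(t)\|\le\varepsilon$ for all $t$, the associated rank one perturbation of the system, $$J\,\frac{d\widetilde{X}(t)}{dt}=(I-uu^TJ)^TH(t)(I-uu^TJ)\widetilde{X}(t),\qquad \widetilde{X}(0)=I+uu^TJ,$$ is stable.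
   Context: $\|\cdot\|$ is the matrix 2-norm and $I=I_{2N}$. Coefficient matrices are assumed integrable over a period $[0,P]$; solutions are locally absolutely continuous functions satisfying the equation almost everywhere. A Hamiltonian system $J\frac{dx}{dt}=H(t)x$ with $H(t)^T=H(t)=H(t+P)$ is called stable if all its solutions are bounded on $\mathbb{R}$. It is called strongly stable if there exists $\epsilon>0$ such that every Hamiltonian system $J\frac{dx(t)}{dt}=\widetilde{H}(t)x(t)$ with $P$-periodic coefficients, $\widetilde{H}(t)^T=\widetilde{H}(t)=\widetilde{H}(t+P)$, satisfying $\int_0^P\|H(t)-\widetilde{H}(t)\|\,dt<\epsilon$ is stable. *)

theory Defs
  imports "HOL-Analysis.Analysis"
begin

text \<open>The library norm on \<^typ>\<open>real^'n^'m\<close> is the Frobenius norm, so the matrix 2-norm is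
  introduced separately.\<close>

definition mat_norm2 :: "real^'n^'m \<Rightarrow> real" where
  "mat_norm2 A = onorm ((*v) A)"

text \<open>The matrix \<open>u u\<^sup>T\<close>.\<close>

definition self_outer :: "real^'n \<Rightarrow> real^'n^'n" where
  "self_outer u = (columnvector u :: real^1^'n) ** (rowvector u :: real^'n^1)"

text \<open>The classical epsilon-delta notion; the library constant \<^const>\<open>absolutely_continuous\<close>
  concerns measures instead.\<close>

definition abs_continuous_on_interval :: "real \<Rightarrow> real \<Rightarrow> (real \<Rightarrow> 'a::real_normed_vector) \<Rightarrow> bool"
  where
  "abs_continuous_on_interval a b f \<longleftrightarrow>
    (\<forall>\<epsilon>>0. \<exists>\<delta>>0. \<forall>(n::nat) s t.
       (\<forall>k<n. a \<le> s k \<and> s k \<le> t k \<and> t k \<le> b) \<and>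
       disjoint_family_on (\<lambda>k. {s k<..<t k}) {..<n} \<and>
       (\<Sum>k<n. t k - s k) < \<delta> \<longrightarrow>
       (\<Sum>k<n. norm (f (t k) - f (s k))) < \<epsilon>)"

definition locally_abs_continuous :: "(real \<Rightarrow> 'a::real_normed_vector) \<Rightarrow> bool" where
  "locally_abs_continuous f \<longleftrightarrow> (\<forall>a b. abs_continuous_on_interval a b f)"

text \<open>Solutions of \<open>J x' = H(t) x\<close>, for vector-valued and for matrix-valued unknowns.\<close>

definition ham_solution :: "real^'n^'n \<Rightarrow> (real \<Rightarrow> real^'n^'n) \<Rightarrow> (real \<Rightarrow> real^'n) \<Rightarrow> bool" where
  "ham_solution J H x \<longleftrightarrow> locally_abs_continuous x \<and>
    (AE t in lebesgue. \<exists>x'. (x has_vector_derivative x') (at t) \<and> J *v x' = H t *v x t)"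

definition ham_matrix_solution ::
    "real^'n^'n \<Rightarrow> (real \<Rightarrow> real^'n^'n) \<Rightarrow> (real \<Rightarrow> real^'n^'n) \<Rightarrow> bool" where
  "ham_matrix_solution J H X \<longleftrightarrow> locally_abs_continuous X \<and>
    (AE t in lebesgue. \<exists>X'. (X has_vector_derivative X') (at t) \<and> J ** X' = H t ** X t)"

definition periodic_ham_coeff :: "real \<Rightarrow> (real \<Rightarrow> real^'n^'n) \<Rightarrow> bool" where
  "periodic_ham_coeff P H \<longleftrightarrow>
    (\<forall>t. transpose (H t) = H t) \<and> (\<forall>t. H (t + P) = H t) \<and>
    H absolutely_integrable_on {0..P}"

definition ham_stable :: "real^'n^'n \<Rightarrow> (real \<Rightarrow> real^'n^'n) \<Rightarrow> bool" where
  "ham_stable J H \<longleftrightarrow> (\<forall>x. ham_solution J H x \<longrightarrow> bounded (range x))"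

definition ham_strongly_stable :: "real^'n^'n \<Rightarrow> real \<Rightarrow> (real \<Rightarrow> real^'n^'n) \<Rightarrow> bool" where
  "ham_strongly_stable J P H \<longleftrightarrow>
    (\<exists>\<epsilon>>0. \<forall>H'. periodic_ham_coeff P H' \<and>
       (LINT t:{0..P}|lebesgue. mat_norm2 (H t - H' t)) < \<epsilon> \<longrightarrow> ham_stable J H')"

definition pert_coeff ::
    "real^'n^'n \<Rightarrow> (real \<Rightarrow> real^'n^'n) \<Rightarrow> real^'n \<Rightarrow> real \<Rightarrow> real^'n^'n" where
  "pert_coeff J H u t =
    transpose (mat 1 - self_outer u ** J) ** H t ** (mat 1 - self_outer u ** J)"

definition pert_error ::
    "real^'n^'n \<Rightarrow> (real \<Rightarrow> real^'n^'n) \<Rightarrow> real^'n \<Rightarrow> real \<Rightarrow> real^'n^'n" where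
  "pert_error J H u t =
    transpose (J ** self_outer u ** H t) + J ** self_outer u ** H t +
    transpose (self_outer u ** J) ** H t ** (self_outer u ** J)"

end

theory Submission
  imports Defs
begin

text \<open>Since \<open>J\<close> is skew-symmetric, \<open>(u u\<^sup>T J)\<^sup>T = - J u u\<^sup>T\<close>, so expanding the product shows that the
  perturbed coefficient is exactly \<open>H + E\<close>. It is again periodic, symmetric and integrable, and a
  uniform bound on \<open>E\<close> bounds its distance to \<open>H\<close> in \<open>L\<^sup>1\<close>, so strong stability applies.
  A matrix solution is bounded because its columns are solutions.\<close>

lemma self_outer_component: "self_outer u $ i $ j = u $ i * u $ j"
  by (simp add: self_outer_def columnvector_def rowvector_def matrix_matrix_mult_def)

lemma transpose_self_outer [simp]: "transpose (self_outer u) = self_outer u"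
  by (simp add: vec_eq_iff transpose_def self_outer_component)

lemma matrix_add_rdistrib: "(A + B) ** C = A ** C + (B ** C :: real^'p^'m)"
  by (simp add: vec_eq_iff matrix_matrix_mult_def sum.distrib distrib_right)

lemma matrix_diff_ldistrib: "A ** (B - C) = A ** B - (A ** C :: real^'p^'m)"
  by (simp add: vec_eq_iff matrix_matrix_mult_def sum_subtractf right_diff_distrib)

lemma matrix_diff_rdistrib: "(A - B) ** C = A ** C - (B ** C :: real^'p^'m)"
  by (simp add: vec_eq_iff matrix_matrix_mult_def sum_subtractf left_diff_distrib)

lemma matrix_mul_minus_left: "(- A) ** B = - (A ** B :: real^'p^'m)"
  by (simp add: vec_eq_iff matrix_matrix_mult_def sum_negf)

lemma matrix_mul_minus_right: "A ** (- B) = - (A ** B :: real^'p^'m)"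
  by (simp add: vec_eq_iff matrix_matrix_mult_def sum_negf)

lemma transpose_diff: "transpose (A - B) = transpose A - transpose B"
  by (simp add: vec_eq_iff transpose_def)

text \<open>By skewness, \<open>transpose (self_outer u ** J)\<close> is
  \<open>- (J ** self_outer u)\<close>, so in the expanded product the two terms of first order in
  \<open>self_outer u\<close> become \<open>J ** self_outer u ** H t\<close> and its
  transpose.\<close>

lemma pert_coeff_eq:
  fixes J :: "real^'n^'n"
  assumes "transpose J = - J" and "transpose (H t) = H t"
  shows "pert_coeff J H u t = H t + pert_error J H u t"
  by (simp add: pert_coeff_def pert_error_def transpose_diff matrix_transpose_mul assms
      matrix_mul_minus_left matrix_mul_minus_right matrix_mul_assoc
      matrix_diff_ldistrib matrix_diff_rdistrib matrix_add_rdistrib)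

lemma mat_norm2_minus: "mat_norm2 (- A) = mat_norm2 (A :: real^'n^'m)"
proof -
  have "(*v) (- A) = (\<lambda>x. - (A *v x))"
    by (auto simp: vec_eq_iff matrix_vector_mult_def sum_negf)
  then show ?thesis
    by (simp add: mat_norm2_def onorm_neg)
qed

text \<open>Congruence by a constant matrix preserves symmetry and is linear in the middle factor,
  hence bounded in finite dimension, so integrability passes through it. With
  \<open>A = mat 1 - self_outer u ** J\<close> this makes the perturbed system a competitor in the
  definition of strong stability.\<close>

lemma periodic_ham_coeff_congruence:
  fixes H :: "real \<Rightarrow> real^'n^'n"
  assumes "periodic_ham_coeff P H"
  shows "periodic_ham_coeff P (\<lambda>t. transpose A ** H t ** A)"
proof -
  have "linear (\<lambda>M :: real^'n^'n. transpose A ** M ** A)"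
    by (rule linearI)
      (simp_all add: matrix_add_ldistrib matrix_add_rdistrib matrix_scalar_ac scalar_matrix_assoc)
  then have "bounded_linear (\<lambda>M :: real^'n^'n. transpose A ** M ** A)"
    by (rule linear_linear[THEN iffD2])
  moreover have "H absolutely_integrable_on {0..P}"
    using assms unfolding periodic_ham_coeff_def by blast
  ultimately have "(\<lambda>t. transpose A ** H t ** A) absolutely_integrable_on {0..P}"
    using absolutely_integrable_linear unfolding o_def by blast
  then show ?thesis
    using assms by (simp add: periodic_ham_coeff_def matrix_transpose_mul matrix_mul_assoc)
qed

text \<open>\<open>f\<close> stretches increments by at most a factor \<open>K\<close>, so the
  \<delta> that \<open>g\<close> provides for \<open>\<epsilon> / K\<close> serves for the
  composition.\<close>

lemma abs_continuous_on_interval_bounded_linear: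
  assumes f: "bounded_linear f" and g: "abs_continuous_on_interval a b g"
  shows "abs_continuous_on_interval a b (\<lambda>x. f (g x))"
  unfolding abs_continuous_on_interval_def
proof (intro allI impI)
  fix \<epsilon> :: real
  assume "\<epsilon> > 0"
  obtain K where K: "K > 0" "\<And>x. norm (f x) \<le> norm x * K"
    using bounded_linear.pos_bounded[OF f] by blast
  have "\<epsilon> / K > 0"
    using \<open>\<epsilon> > 0\<close> K by simp
  then obtain \<delta> where \<delta>: "\<delta> > 0" and small: "\<And>(n::nat) s t.
      (\<forall>k<n. a \<le> s k \<and> s k \<le> t k \<and> t k \<le> b) \<and>
      disjoint_family_on (\<lambda>k. {s k<..<t k}) {..<n} \<and> (\<Sum>k<n. t k - s k) < \<delta> \<Longrightarrow>
      (\<Sum>k<n. norm (g (t k) - g (s k))) < \<epsilon> / K"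
    using g unfolding abs_continuous_on_interval_def by meson
  have "(\<Sum>k<n. norm (f (g (t k)) - f (g (s k)))) < \<epsilon>"
    if st: "(\<forall>k<n. a \<le> s k \<and> s k \<le> t k \<and> t k \<le> b) \<and>
      disjoint_family_on (\<lambda>k. {s k<..<t k}) {..<n} \<and> (\<Sum>k<n. t k - s k) < \<delta>"
    for n :: nat and s t
  proof -
    have "(\<Sum>k<n. norm (f (g (t k)) - f (g (s k)))) \<le> (\<Sum>k<n. norm (g (t k) - g (s k)) * K)"
      by (intro sum_mono) (metis K(2) bounded_linear.linear f linear_diff)
    also have "\<dots> < \<epsilon>"
      using small[OF st] K(1) by (simp add: sum_distrib_right[symmetric] pos_less_divide_eq)
    finally show ?thesis .
  qed
  with \<delta> show "\<exists>\<delta>>0. \<forall>(n::nat) s t.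
      (\<forall>k<n. a \<le> s k \<and> s k \<le> t k \<and> t k \<le> b) \<and>
      disjoint_family_on (\<lambda>k. {s k<..<t k}) {..<n} \<and> (\<Sum>k<n. t k - s k) < \<delta> \<longrightarrow>
      (\<Sum>k<n. norm (f (g (t k)) - f (g (s k)))) < \<epsilon>"
    by blast
qed

lemma ham_matrix_solution_mult_vec:
  fixes X :: "real \<Rightarrow> real^'n^'n"
  assumes "ham_matrix_solution J H X"
  shows "ham_solution J H (\<lambda>t. X t *v v)"
proof -
  have lin: "bounded_linear (\<lambda>M :: real^'n^'n. M *v v)"
    by (intro linear_conv_bounded_linear[THEN iffD1] linearI)
      (simp_all add: matrix_vector_mult_add_rdistrib scaleR_matrix_vector_assoc)
  have "AE t in lebesgue. \<exists>x'. ((\<lambda>t. X t *v v) has_vector_derivative x') (at t) \<and>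
      J *v x' = H t *v (X t *v v)"
    \<comment> \<open>Wherever \<open>X\<close> has derivative \<open>X'\<close>, the product has
      derivative \<open>X' *v v\<close>, so the exceptional null set is the same; associativity then
      carries the matrix equation over to \<open>v\<close>.\<close>
    using assms unfolding ham_matrix_solution_def
    by (elim conjE AE_mp, intro AE_I2)
      (metis bounded_linear.has_vector_derivative[OF lin] matrix_vector_mul_assoc)
  then show ?thesis
    using assms abs_continuous_on_interval_bounded_linear[OF lin]
    by (simp add: ham_solution_def ham_matrix_solution_def locally_abs_continuous_def)
qed

text \<open>The norm of a matrix is at most the sum of the absolute values of its entries, and each
  entry is at most the norm of its column.\<close>

lemma bounded_matrix_columns:
  fixes X :: "'a \<Rightarrow> real^'n^'m"
  assumes "\<And>j. bounded (range (\<lambda>t. column j (X t)))"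
  shows "bounded (range X)"
proof -
  have "\<exists>B. \<forall>t. norm (column j (X t)) \<le> B" for j
    using assms[of j] by (auto simp: bounded_iff)
  then obtain B where B: "\<And>j t. norm (column j (X t)) \<le> B j"
    by metis
  have "norm (X t) \<le> (\<Sum>i\<in>(UNIV::'m set). \<Sum>j\<in>UNIV. B j)" for t
  proof -
    have "norm (X t) \<le> (\<Sum>i\<in>UNIV. norm (X t $ i))"
      unfolding norm_vec_def by (rule L2_set_le_sum) simp
    also have "\<dots> \<le> (\<Sum>i\<in>UNIV. \<Sum>j\<in>UNIV. \<bar>X t $ i $ j\<bar>)"
      by (intro sum_mono norm_le_l1_cart)
    also have "\<dots> \<le> (\<Sum>i\<in>(UNIV::'m set). \<Sum>j\<in>UNIV. B j)"
    proof (intro sum_mono)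
      fix i j
      have "\<bar>X t $ i $ j\<bar> \<le> norm (column j (X t))"
        using component_le_norm_cart[of "column j (X t)" i] by (simp add: column_def)
      also have "\<dots> \<le> B j"
        by (rule B)
      finally show "\<bar>X t $ i $ j\<bar> \<le> B j" .
    qed
    finally show ?thesis .
  qed
  then show ?thesis
    by (auto simp: bounded_iff)
qed

lemma ham_stable_bounded_matrix_solution:
  assumes "ham_stable J H" and "ham_matrix_solution J H X"
  shows "bounded (range X)"
proof (rule bounded_matrix_columns)
  fix j
  show "bounded (range (\<lambda>t. column j (X t)))"
    \<comment> \<open>Applying \<open>X t\<close> to the basis vector \<open>axis j 1\<close> yields
      its column \<open>j\<close>.\<close>
    using assms ham_matrix_solution_mult_vec[OF assms(2), of "axis j 1"]
    by (simp add: ham_stable_def matrix_vector_mult_basis)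
qed

theorem proposition17:
  fixes J :: "real^'n^'n" and H :: "real \<Rightarrow> real^'n^'n" and P :: real and N :: nat
  assumes "N \<ge> 1" and "CARD('n) = 2 * N"
    and "P > 0"
    and "invertible J" and "transpose J = - J"
    and "periodic_ham_coeff P H"
    and "ham_strongly_stable J P H"
  shows "\<exists>\<epsilon>>0. \<forall>u :: real^'n.
    (\<forall>t. mat_norm2 (pert_error J H u t) \<le> \<epsilon>) \<longrightarrow>
    ham_stable J (pert_coeff J H u) \<and>
    (\<forall>Xt. ham_matrix_solution J (pert_coeff J H u) Xt \<and> Xt 0 = mat 1 + self_outer u ** J
      \<longrightarrow> bounded (range Xt))"
proof -
  note skew = \<open>transpose J = - J\<close> and coeff = \<open>periodic_ham_coeff P H\<close>
  obtain \<epsilon> where "\<epsilon> > 0" and stable: "\<And>H'. periodic_ham_coeff P H' \<Longrightarrow>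
      (LINT t:{0..P}|lebesgue. mat_norm2 (H t - H' t)) < \<epsilon> \<Longrightarrow> ham_stable J H'"
    using \<open>ham_strongly_stable J P H\<close> by (auto simp: ham_strongly_stable_def)
  have "ham_stable J (pert_coeff J H u)"
    \<comment> \<open>Integrated over a period of length \<open>P\<close>, this bound gives
      \<open>\<epsilon> / 2\<close>; the factor 2 secures the strict inequality that strong
      stability asks for.\<close>
    if u: "\<forall>t. mat_norm2 (pert_error J H u t) \<le> \<epsilon> / (2 * P)" for u
  proof (rule stable)
    show "periodic_ham_coeff P (pert_coeff J H u)"
      using periodic_ham_coeff_congruence[OF coeff] by (simp add: pert_coeff_def[abs_def])
    \<comment> \<open>Strong stability measures the original coefficient minus the new one, hence
      the sign, which the norm then absorbs.\<close>
    have "H t - pert_coeff J H u t = - pert_error J H u t" for t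
      using coeff by (simp add: pert_coeff_eq skew periodic_ham_coeff_def)
    then have "mat_norm2 (H t - pert_coeff J H u t) \<le> \<epsilon> / (2 * P)" for t
      using u by (simp add: mat_norm2_minus)
    \<comment> \<open>\<open>integral_mono'\<close> needs no integrability of the smaller function: its integral is \<open>0\<close> otherwise.\<close>
    then have "(LINT t:{0..P}|lebesgue. mat_norm2 (H t - pert_coeff J H u t))
        \<le> (LINT t:{0..P}|lebesgue. \<epsilon> / (2 * P))"
      unfolding set_lebesgue_integral_def
    proof (intro integral_mono')
      show "integrable lebesgue (\<lambda>t. indicator {0..P} t *\<^sub>R (\<epsilon> / (2 * P)))"
        by (intro integrable_scaleR_left integrable_real_indicator) (auto simp: emeasure_lborel_Icc_eq)
    \<comment> \<open>What remains is pointwise domination and nonnegativity of the dominating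
      function, checked inside and outside the period.\<close>
    qed (use \<open>\<epsilon> > 0\<close> \<open>P > 0\<close> in \<open>auto simp: indicator_def\<close>)
    also have "\<dots> = \<epsilon> / 2"
      using \<open>P > 0\<close> by (simp add: set_lebesgue_integral_def)
    finally show "(LINT t:{0..P}|lebesgue. mat_norm2 (H t - pert_coeff J H u t)) < \<epsilon>"
      using \<open>\<epsilon> > 0\<close> by simp
  qed
  then show ?thesis
    using \<open>\<epsilon> > 0\<close> \<open>P > 0\<close> ham_stable_bounded_matrix_solution
    by (intro exI[of _ "\<epsilon> / (2 * P)"]) auto
qed

end
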